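(* Let $\varphi:\mathbb{R}^n\to\mathbb{R}$ be a $1$-Lipschitz function with respect to the Euclidean norm, and let $X,Y$ be two independent $n$-dimensional Gaussian random vectors, each with distribution $\gamma_n$. Then for every real number $\lambda$, $$\mathbb{E}\, \exp\Big(\frac{\lambda}{\sqrt2}\big(\varphi(X)-\varphi(Y)\big)\Big)\le e^{\lambda^2/2}.$$
   Context: $\gamma_n$ is the standard Gaussian probability measure on $\mathbb{R}^n$, i.e. the product of $n$ copies of the measure on $\mathbb{R}$ with density $\frac{1}{\sqrt{2\pi}}e^{-x^2/2}$. *)

theory Defs
  imports "HOL-Probability.Probability"
begin

definition std_gaussian_1d :: "real measure" where
  "std_gaussian_1d = density lborel (\<lambda>x. ennreal (std_normal_density x))"

text \<open>Elements of \<open>PiM\<close> are functions \<open>'n \<Rightarrow> real\<close>, hence the push-forward along \<open>vec_lambda\<close>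
  to the type of vectors.\<close>

definition std_gaussian :: "(real ^ 'n) measure" where
  "std_gaussian = distr (\<Pi>\<^sub>M i\<in>(UNIV :: 'n set). std_gaussian_1d) borel (\<lambda>x. \<chi> i. x i)"

end

theory Submission
  imports Defs
begin

text \<open>
  Maurey's property \<open>(\<tau>)\<close>: if \<open>u x * v y \<le> exp (\<bar>x - y\<bar>\<^sup>2 / 4)\<close> for all \<open>x\<close> and \<open>y\<close>, then
  \<open>(\<integral>u \<partial>\<gamma>) * (\<integral>v \<partial>\<gamma>) \<le> 1\<close>. For \<open>t = \<lambda> / sqrt 2\<close> the functions \<open>u = exp (t \<phi> - t\<^sup>2)\<close> and
  \<open>v = exp (- t \<phi>)\<close> qualify, since \<open>\<bar>t\<bar> \<bar>x - y\<bar> \<le> t\<^sup>2 + \<bar>x - y\<bar>\<^sup>2 / 4\<close>, and this yields the sharp constant.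
  The property tensorizes by Fubini; in dimension one it is the Prekopa--Leindler inequality at the
  midpoint, by the parallelogram identity for the exponent of the Gaussian density.
\<close>

section \<open>The Brunn--Minkowski inequality on the real line\<close>

lemma emeasure_lborel_translate:
  fixes A :: "real set"
  assumes [measurable]: "A \<in> sets borel"
  shows "emeasure lborel ((\<lambda>x. x - c) -` A) = emeasure lborel A"
proof -
  have "emeasure lborel A = emeasure (distr lborel borel ((+) (- c))) A"
    by (simp add: lborel_distr_plus)
  also have "\<dots> = emeasure lborel ((\<lambda>x. x - c) -` A)"
    by (subst emeasure_distr) (auto simp: vimage_def)
  finally show ?thesis by simp
qed

text \<open>The set \<open>C\<close> is any Borel set containing all the sums, because the sumset of
  two Borel sets need not be Borel. Only the top of \<open>A\<close> and the bottom of
  \<open>B\<close> are bounded: these are the ends at which the two translates meet.\<close>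

lemma brunn_minkowski_real_bdd:
  fixes A B C :: "real set"
  assumes [measurable]: "A \<in> sets borel" "B \<in> sets borel" "C \<in> sets borel"
    and ne: "A \<noteq> {}" "B \<noteq> {}"
    and bdd: "bdd_above A" "bdd_below B"
    and sub: "\<And>a b. a \<in> A \<Longrightarrow> b \<in> B \<Longrightarrow> a + b \<in> C"
  shows "emeasure lborel A + emeasure lborel B \<le> emeasure lborel C"
proof (rule ennreal_le_epsilon)
  fix e :: real assume e: "0 < e"
  obtain a where a: "a \<in> A" "Sup A - e / 2 < a"
    using less_cSupD[OF ne(1), of "Sup A - e / 2"] e by auto
  obtain b where b: "b \<in> B" "b < Inf B + e / 2"
    using cInf_lessD[OF ne(2), of "Inf B + e / 2"] e by auto
  define A' where "A' = (\<lambda>x. x - b) -` A"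
  define B' where "B' = (\<lambda>x. x - a) -` B"
  have [measurable]: "A' \<in> sets borel" "B' \<in> sets borel"
    unfolding A'_def B'_def by (rule measurable_sets_borel; measurable)+
  \<comment> \<open>The translates \<open>A + b\<close> and \<open>a + B\<close> lie in \<open>C\<close> and overlap in a set of length at most \<open>e\<close>.\<close>
  have "A' \<inter> B' \<subseteq> {a + Inf B .. Sup A + b}"
    using cSup_upper[OF _ bdd(1)] cInf_lower[OF _ bdd(2)]
    by (force simp: A'_def B'_def)
  then have "emeasure lborel (A' \<inter> B') \<le> emeasure lborel {a + Inf B .. Sup A + b}"
    by (intro emeasure_mono) auto
  also have "\<dots> \<le> ennreal e"
    using a b by (simp add: emeasure_lborel_Icc_eq ennreal_leI)
  finally have int: "emeasure lborel (A' \<inter> B') \<le> ennreal e" .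
  have "emeasure lborel A + emeasure lborel B = emeasure lborel A' + emeasure lborel B'"
    by (simp add: A'_def B'_def emeasure_lborel_translate)
  also have "\<dots> = emeasure lborel (A' \<union> B') + emeasure lborel (A' \<inter> B')"
    by (rule emeasure_Un_Int) auto
  also have "\<dots> \<le> emeasure lborel C + ennreal e"
  proof (rule add_mono[OF _ int])
    have "A' \<union> B' \<subseteq> C"
      using sub[OF _ b(1)] sub[OF a(1)] by (force simp: A'_def B'_def)
    then show "emeasure lborel (A' \<union> B') \<le> emeasure lborel C"
      by (intro emeasure_mono) auto
  qed
  finally show "emeasure lborel A + emeasure lborel B \<le> emeasure lborel C + ennreal e" .
qed

text \<open>Cutting \<open>A\<close> from above and \<open>B\<close> from below produces increasing
  sequences covered by the bounded case; continuity of the measure from below gives the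
  limit.\<close>

lemma brunn_minkowski_real:
  fixes A B C :: "real set"
  assumes [measurable]: "A \<in> sets borel" "B \<in> sets borel" "C \<in> sets borel"
    and ne: "A \<noteq> {}" "B \<noteq> {}"
    and sub: "\<And>a b. a \<in> A \<Longrightarrow> b \<in> B \<Longrightarrow> a + b \<in> C"
  shows "emeasure lborel A + emeasure lborel B \<le> emeasure lborel C"
proof -
  define A' where "A' n = A \<inter> {.. real n}" for n
  define B' where "B' n = B \<inter> {- real n ..}" for n
  have "(\<lambda>n. emeasure lborel (A' n)) \<longlonglongrightarrow> emeasure lborel (\<Union>n. A' n)"
    by (rule Lim_emeasure_incseq) (auto simp: A'_def incseq_def)
  moreover have "(\<Union>n. A' n) = A"
    using real_arch_simple by (auto simp: A'_def)
  ultimately have limA: "(\<lambda>n. emeasure lborel (A' n)) \<longlonglongrightarrow> emeasure lborel A" by simp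
  have "(\<lambda>n. emeasure lborel (B' n)) \<longlonglongrightarrow> emeasure lborel (\<Union>n. B' n)"
    by (rule Lim_emeasure_incseq) (auto simp: B'_def incseq_def)
  moreover have "(\<Union>n. B' n) = B"
  proof -
    have "\<exists>n. - real n \<le> x" for x
      using real_arch_simple[of "- x"] by (auto simp: minus_le_iff)
    then show ?thesis by (auto simp: B'_def)
  qed
  ultimately have limB: "(\<lambda>n. emeasure lborel (B' n)) \<longlonglongrightarrow> emeasure lborel B" by simp
  obtain a b where ab: "a \<in> A" "b \<in> B" using ne by auto
  \<comment> \<open>From \<open>N\<close> on, the truncations still contain \<open>a\<close> and
    \<open>b\<close>, hence are nonempty as the bounded case demands.\<close>
  obtain N where N: "\<bar>a\<bar> + \<bar>b\<bar> \<le> real N" using real_arch_simple by blast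
  have "emeasure lborel (A' n) + emeasure lborel (B' n) \<le> emeasure lborel C" if "n \<ge> N" for n
  proof (rule brunn_minkowski_real_bdd)
    have "\<bar>a\<bar> + \<bar>b\<bar> \<le> real n" using N that by linarith
    then have "a \<in> A' n" "b \<in> B' n" using ab by (auto simp: A'_def B'_def)
    then show "A' n \<noteq> {}" "B' n \<noteq> {}" by auto
  qed (auto simp: A'_def B'_def intro: sub)
  then show ?thesis
    using tendsto_add[OF limA limB] by (intro LIMSEQ_le_const2) auto
qed

section \<open>The Prekopa--Leindler inequality on the real line\<close>

text \<open>The value \<open>f x\<close> is the length of \<open>{0..<f x}\<close>; Fubini then
  exchanges the integrals over the point \<open>x\<close> and the level \<open>t\<close>.\<close>

lemma nn_integral_layer_cake:
  fixes f :: "real \<Rightarrow> real"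
  assumes [measurable]: "f \<in> borel_measurable borel"
    and nonneg: "\<And>x. 0 \<le> f x"
  shows "(\<integral>\<^sup>+x. ennreal (f x) \<partial>lborel)
    = (\<integral>\<^sup>+t. emeasure lborel {x. t < f x} * indicator {0..} t \<partial>lborel)"
proof -
  have "(\<integral>\<^sup>+x. ennreal (f x) \<partial>lborel)
      = (\<integral>\<^sup>+x. (\<integral>\<^sup>+t. indicator {0..<f x} t \<partial>lborel) \<partial>lborel)"
    by (intro nn_integral_cong) (simp add: nonneg)
  also have "\<dots> = (\<integral>\<^sup>+x. (\<integral>\<^sup>+t. indicator {x. t < f x} x * indicator {0..} t \<partial>lborel) \<partial>lborel)"
    by (intro nn_integral_cong) (auto simp: indicator_def)
  also have "\<dots> = (\<integral>\<^sup>+t. (\<integral>\<^sup>+x. indicator {x. t < f x} x * indicator {0..} t \<partial>lborel) \<partial>lborel)"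
    by (rule lborel_pair.Fubini'[symmetric]) measurable
  also have "\<dots> = (\<integral>\<^sup>+t. emeasure lborel {x. t < f x} * indicator {0..} t \<partial>lborel)"
    by (intro nn_integral_cong) (simp add: nn_integral_multc)
  finally show ?thesis .
qed

lemma borel_measurable_emeasure_superlevel [measurable]:
  fixes f :: "real \<Rightarrow> real"
  assumes [measurable]: "f \<in> borel_measurable borel"
  shows "(\<lambda>t. emeasure lborel {x. t < f x}) \<in> borel_measurable borel"
proof -
  have "(\<lambda>t. \<integral>\<^sup>+x. indicator {x. t < f x} x \<partial>lborel) \<in> borel_measurable borel"
    by measurable
  then show ?thesis by simp
qed

text \<open>Points at which \<open>f\<close> and \<open>g\<close> exceed a level in [0, 1) add up to
  a point at which \<open>k\<close> exceeds it, so Brunn--Minkowski holds level by level and the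
  layer cake formula integrates it. Taking \<open>k\<close> at \<open>x + y\<close> instead of the
  midpoint avoids scaling sets.\<close>

lemma prekopa_leindler_normalized:
  fixes f g k :: "real \<Rightarrow> real"
  assumes [measurable]: "f \<in> borel_measurable borel" "g \<in> borel_measurable borel"
      "k \<in> borel_measurable borel"
    and f: "\<And>x. 0 \<le> f x" "\<And>x. f x \<le> 1" "\<And>t. t < 1 \<Longrightarrow> \<exists>x. t < f x"
    and g: "\<And>x. 0 \<le> g x" "\<And>x. g x \<le> 1" "\<And>t. t < 1 \<Longrightarrow> \<exists>x. t < g x"
    and k: "\<And>x. 0 \<le> k x"
    and le: "\<And>x y. f x * g y \<le> (k (x + y))\<^sup>2"
  shows "(\<integral>\<^sup>+x. f x \<partial>lborel) + (\<integral>\<^sup>+x. g x \<partial>lborel) \<le> (\<integral>\<^sup>+x. k x \<partial>lborel)"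
proof -
  have "emeasure lborel {x. t < f x} * indicator {0..} t
      + emeasure lborel {x. t < g x} * indicator {0..} t
      \<le> emeasure lborel {x. t < k x} * indicator {0..} t" for t
  proof (cases "0 \<le> t \<and> t < 1")
    case True
    have "emeasure lborel {x. t < f x} + emeasure lborel {x. t < g x}
        \<le> emeasure lborel {x. t < k x}"
    proof (rule brunn_minkowski_real)
      fix a b assume "a \<in> {x. t < f x}" "b \<in> {x. t < g x}"
      then have "t * t < f a * g b"
        using True by (intro mult_strict_mono) auto
      then have "t\<^sup>2 < (k (a + b))\<^sup>2"
        using le[of a b] by (simp add: power2_eq_square)
      then show "a + b \<in> {x. t < k x}"
        using power2_less_imp_less k by blast
    qed (use True f(3) g(3) in auto)
    with True show ?thesis by simp
  next
    \<comment> \<open>The indicator removes negative levels, and from level \<open>1\<close> on the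
      sets on the left are empty.\<close>
    case False
    have "{x. t < f x} = {}" "{x. t < g x} = {}" if "1 \<le> t"
      using that f(2) g(2) by (force simp: not_less intro: order_trans)+
    with False show ?thesis by (auto simp: indicator_def)
  qed
  then show ?thesis
    by (simp add: nn_integral_layer_cake f(1) g(1) k nn_integral_add[symmetric] nn_integral_mono)
qed

text \<open>The normalized inequality bounds a sum of integrals; the arithmetic-geometric mean
  inequality turns this into the bound on their product. Finiteness of the right-hand integral lets
  this be done in the reals.\<close>

lemma prekopa_leindler_real:
  fixes f g h :: "real \<Rightarrow> real"
  assumes [measurable]: "f \<in> borel_measurable borel" "g \<in> borel_measurable borel"
      "h \<in> borel_measurable borel"
    and f: "\<And>x. 0 \<le> f x" "bdd_above (range f)"
    and g: "\<And>x. 0 \<le> g x" "bdd_above (range g)"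
    and h: "\<And>x. 0 \<le> h x"
    and le: "\<And>x y. f x * g y \<le> (h ((x + y) / 2))\<^sup>2"
    and fin: "(\<integral>\<^sup>+x. h x \<partial>lborel) < \<infinity>"
  shows "(\<integral>\<^sup>+x. f x \<partial>lborel) * (\<integral>\<^sup>+x. g x \<partial>lborel) \<le> (\<integral>\<^sup>+x. h x \<partial>lborel)\<^sup>2"
proof (cases "(\<exists>x. 0 < f x) \<and> (\<exists>x. 0 < g x)")
  case False
  then have "(\<forall>x. f x = 0) \<or> (\<forall>x. g x = 0)"
    using f(1) g(1) by (metis order_le_less)
  then show ?thesis by auto
next
  case True
  \<comment> \<open>Both functions are scaled to have supremum \<open>1\<close>, so that all superlevel sets at levels below \<open>1\<close>
    are nonempty and the one-dimensional Brunn--Minkowski inequality applies to them.\<close>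
  define S where "S = Sup (range f)"
  define T where "T = Sup (range g)"
  have fS: "f x \<le> S" for x unfolding S_def by (intro cSup_upper f) auto
  have gT: "g x \<le> T" for x unfolding T_def by (intro cSup_upper g) auto
  have S: "0 < S" using True fS by (meson less_le_trans)
  have T: "0 < T" using True gT by (meson less_le_trans)
  \<comment> \<open>With this \<open>c\<close>, the function \<open>c * h (x / 2)\<close> satisfies
    the product hypothesis for the scaled functions \<open>f / S\<close> and
    \<open>g / T\<close>.\<close>
  define c where "c = 1 / sqrt (S * T)"
  have c: "0 < c" "c\<^sup>2 * (S * T) = 1"
    using S T by (auto simp: c_def power_divide)
  have "(\<integral>\<^sup>+x. ennreal (f x / S) \<partial>lborel) + (\<integral>\<^sup>+x. ennreal (g x / T) \<partial>lborel)
      \<le> (\<integral>\<^sup>+x. ennreal (c * h (x / 2)) \<partial>lborel)"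
  proof (rule prekopa_leindler_normalized)
    show "\<exists>x. t < f x / S" if "t < 1" for t
      using less_cSupD[of "range f" "t * S"] that S by (auto simp: S_def[symmetric] field_simps)
    show "\<exists>x. t < g x / T" if "t < 1" for t
      using less_cSupD[of "range g" "t * T"] that T by (auto simp: T_def[symmetric] field_simps)
    show "f x / S * (g y / T) \<le> (c * h ((x + y) / 2))\<^sup>2" for x y
    proof -
      have "f x / S * (g y / T) = c\<^sup>2 * (f x * g y)"
        using c(2) S T by (simp add: field_simps)
      also have "\<dots> \<le> c\<^sup>2 * (h ((x + y) / 2))\<^sup>2"
        by (intro mult_left_mono le) auto
      finally show ?thesis by (simp add: power_mult_distrib)
    qed
  qed (use S T c f(1) g(1) h fS gT in auto)
  also have "\<dots> = ennreal c * (\<integral>\<^sup>+x. ennreal (h (x / 2)) \<partial>lborel)"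
    using c h by (subst nn_integral_cmult[symmetric]) (auto simp: ennreal_mult)
  \<comment> \<open>The substitution \<open>x = 2 * y\<close> produces the factor \<open>2\<close>,
    whose square cancels the \<open>4\<close> of the mean inequality below.\<close>
  also have "\<dots> = ennreal c * (2 * (\<integral>\<^sup>+x. h x \<partial>lborel))"
    by (subst nn_integral_real_affine[where c=2 and t=0 and f = "\<lambda>x. ennreal (h (x / 2))"]) auto
  finally have *: "(\<integral>\<^sup>+x. ennreal (f x / S) \<partial>lborel) + (\<integral>\<^sup>+x. ennreal (g x / T) \<partial>lborel)
      \<le> ennreal c * (2 * (\<integral>\<^sup>+x. h x \<partial>lborel))" .
  obtain H where H: "0 \<le> H" "(\<integral>\<^sup>+x. h x \<partial>lborel) = ennreal H"
    using fin by (cases "\<integral>\<^sup>+x. h x \<partial>lborel") auto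
  have rhs: "ennreal c * (2 * ennreal H) = ennreal (2 * c * H)"
    using c H(1) by (simp add: ennreal_mult mult_ac)
  obtain F where F: "0 \<le> F" "(\<integral>\<^sup>+x. ennreal (f x / S) \<partial>lborel) = ennreal F"
    using * unfolding H rhs
    by (cases "\<integral>\<^sup>+x. ennreal (f x / S) \<partial>lborel") (auto simp: top_unique)
  obtain G where G: "0 \<le> G" "(\<integral>\<^sup>+x. ennreal (g x / T) \<partial>lborel) = ennreal G"
    using * unfolding H rhs
    by (cases "\<integral>\<^sup>+x. ennreal (g x / T) \<partial>lborel") (auto simp: top_unique)
  have FG: "F + G \<le> 2 * c * H"
    using * c H(1) F(1) G(1) unfolding H rhs F G by (simp flip: ennreal_plus)
  have "4 * (F * G) \<le> (F + G)\<^sup>2"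
    using zero_le_power2[of "F - G"] by (simp add: power2_eq_square algebra_simps)
  also have "\<dots> \<le> (2 * c * H)\<^sup>2"
    using FG F(1) G(1) by (intro power_mono) auto
  finally have "F * G \<le> c\<^sup>2 * H\<^sup>2" by (simp add: power_mult_distrib)
  then have "(S * F) * (T * G) \<le> (S * T) * (c\<^sup>2 * H\<^sup>2)"
    using mult_left_mono[of _ _ "S * T"] S T by (fastforce simp: mult_ac)
  also have "\<dots> = (c\<^sup>2 * (S * T)) * H\<^sup>2" by (simp add: mult_ac)
  also have "\<dots> = H\<^sup>2" unfolding c by simp
  finally have fin: "(S * F) * (T * G) \<le> H\<^sup>2" .
  have "(\<integral>\<^sup>+x. f x \<partial>lborel) = ennreal (S * F)"
  proof -
    have "(\<integral>\<^sup>+x. f x \<partial>lborel) = (\<integral>\<^sup>+x. ennreal S * ennreal (f x / S) \<partial>lborel)"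
      using S f(1) by (intro nn_integral_cong) (simp flip: ennreal_mult)
    also have "\<dots> = ennreal (S * F)"
      using S F by (simp add: nn_integral_cmult ennreal_mult)
    finally show ?thesis .
  qed
  moreover have "(\<integral>\<^sup>+x. g x \<partial>lborel) = ennreal (T * G)"
  proof -
    have "(\<integral>\<^sup>+x. g x \<partial>lborel) = (\<integral>\<^sup>+x. ennreal T * ennreal (g x / T) \<partial>lborel)"
      using T g(1) by (intro nn_integral_cong) (simp flip: ennreal_mult)
    also have "\<dots> = ennreal (T * G)"
      using T G by (simp add: nn_integral_cmult ennreal_mult)
    finally show ?thesis .
  qed
  ultimately show ?thesis
    using fin S T F(1) G(1) H(1)
    by (simp add: H ennreal_mult[symmetric] ennreal_power ennreal_leI)
qed

section \<open>Property (tau) for the Gaussian measure on the line\<close>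

lemma prob_space_std_gaussian_1d: "prob_space std_gaussian_1d"
  unfolding std_gaussian_1d_def by (rule prob_space_normal_density) simp

lemma sets_std_gaussian_1d [measurable_cong, simp]: "sets std_gaussian_1d = sets borel"
  by (simp add: std_gaussian_1d_def)

lemma space_std_gaussian_1d [simp]: "space std_gaussian_1d = UNIV"
  by (simp add: std_gaussian_1d_def)

text \<open>The functions take values in \<open>ennreal\<close> because the induction on the
  dimension applies this to partial integrals not known to be finite.\<close>

lemma std_gaussian_1d_property_tau:
  fixes u v :: "real \<Rightarrow> ennreal"
  assumes [measurable]: "u \<in> borel_measurable borel" "v \<in> borel_measurable borel"
    and le: "\<And>x y. u x * v y \<le> ennreal (exp ((x - y)\<^sup>2 / 4))"
  shows "(\<integral>\<^sup>+x. u x \<partial>std_gaussian_1d) * (\<integral>\<^sup>+x. v x \<partial>std_gaussian_1d) \<le> 1"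
proof (cases "(\<exists>x. u x \<noteq> 0) \<and> (\<exists>x. v x \<noteq> 0)")
  case False
  then show ?thesis by auto
next
  case True
  then obtain x0 y0 where xy0: "u x0 \<noteq> 0" "v y0 \<noteq> 0" by auto
  \<comment> \<open>An infinite value of \<open>u\<close> times the nonzero \<open>v y0\<close>
    would be infinite, against the finite bound.\<close>
  have ufin: "u x < \<infinity>" for x
    using le[of x y0] xy0 by (cases "u x") (auto simp: ennreal_top_mult top_unique)
  have vfin: "v y < \<infinity>" for y
    using le[of x0 y] xy0 by (cases "v y") (auto simp: ennreal_mult_top top_unique)
  define f where "f x = enn2real (u x) * std_normal_density x" for x
  define g where "g x = enn2real (v x) * std_normal_density x" for x
  have [measurable]: "f \<in> borel_measurable borel" "g \<in> borel_measurable borel"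
    unfolding f_def g_def by measurable
  have nonneg: "0 \<le> f x" "0 \<le> g x" for x
    by (simp_all add: f_def g_def)
  have fg: "f x * g y \<le> (std_normal_density ((x + y) / 2))\<^sup>2" for x y
  proof -
    have "enn2real (u x) * enn2real (v y) = enn2real (u x * v y)"
      by (simp add: enn2real_mult)
    also have "\<dots> \<le> exp ((x - y)\<^sup>2 / 4)"
      using enn2real_mono[OF le[of x y]] by simp
    finally have "f x * g y \<le> exp ((x - y)\<^sup>2 / 4) * (std_normal_density x * std_normal_density y)"
      unfolding f_def g_def
      using mult_right_mono[of _ _ "std_normal_density x * std_normal_density y"]
      by (fastforce simp: mult_ac)
    also have "\<dots> = (1 / sqrt (2 * pi))\<^sup>2 * exp ((x - y)\<^sup>2 / 4 + (- x\<^sup>2 / 2) + (- y\<^sup>2 / 2))"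
      by (simp only: std_normal_density_def exp_add power2_eq_square) (simp add: mult_ac)
    \<comment> \<open>This is the parallelogram identity; the factor \<open>2\<close> becomes the
      square of the density at the midpoint.\<close>
    also have "(x - y)\<^sup>2 / 4 + (- x\<^sup>2 / 2) + (- y\<^sup>2 / 2) = 2 * (- ((x + y) / 2)\<^sup>2 / 2)"
      by (simp add: power2_eq_square field_simps)
    also have "(1 / sqrt (2 * pi))\<^sup>2 * exp \<dots> = (std_normal_density ((x + y) / 2))\<^sup>2"
      by (simp only: std_normal_density_def exp_double power_mult_distrib)
    finally show ?thesis .
  qed
  \<comment> \<open>Although \<open>u\<close> may be unbounded, \<open>f\<close> is bounded: fixing
    \<open>y0\<close> with \<open>g y0 > 0\<close>, the bound \<open>fg\<close> and this crude
    estimate give \<open>f x * g y0 \<le> 1\<close>. The same works for \<open>g\<close>.\<close>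
  have dens: "(std_normal_density z)\<^sup>2 \<le> 1" for z
  proof (rule power_le_one)
    have "1 \<le> sqrt (2 * pi)" using pi_gt3 by (intro real_le_rsqrt) auto
    then show "std_normal_density z \<le> 1"
      by (simp add: std_normal_density_def divide_le_eq)
         (rule order_trans[of _ 1], simp_all)
  qed simp
  have "0 < g y0" "0 < f x0"
    using xy0 ufin[of x0] vfin[of y0]
    by (auto simp: f_def g_def enn2real_positive_iff zero_less_iff_neq_zero normal_density_pos)
  then have "f x \<le> 1 / g y0" "g x \<le> 1 / f x0" for x
    using order_trans[OF fg[of x y0] dens] order_trans[OF fg[of x0 x] dens]
    by (simp_all add: field_simps)
  then have bdd: "bdd_above (range f)" "bdd_above (range g)"
    by (auto intro!: bdd_aboveI2)
  have one: "(\<integral>\<^sup>+x. std_normal_density x \<partial>lborel) = 1"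
    using prob_space.emeasure_space_1[OF prob_space_std_gaussian_1d]
    by (simp add: std_gaussian_1d_def emeasure_density)
  have "(\<integral>\<^sup>+x. f x \<partial>lborel) * (\<integral>\<^sup>+x. g x \<partial>lborel) \<le> (\<integral>\<^sup>+x. std_normal_density x \<partial>lborel)\<^sup>2"
    by (rule prekopa_leindler_real) (auto simp: nonneg bdd fg one)
  moreover have "(\<integral>\<^sup>+x. u x \<partial>std_gaussian_1d) = (\<integral>\<^sup>+x. f x \<partial>lborel)"
    using ufin unfolding std_gaussian_1d_def f_def
    by (subst nn_integral_density) (auto simp: ennreal_mult mult_ac intro!: nn_integral_cong)
  moreover have "(\<integral>\<^sup>+x. v x \<partial>std_gaussian_1d) = (\<integral>\<^sup>+x. g x \<partial>lborel)"
    using vfin unfolding std_gaussian_1d_def g_def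
    by (subst nn_integral_density) (auto simp: ennreal_mult mult_ac intro!: nn_integral_cong)
  ultimately show ?thesis by (simp add: one)
qed

section \<open>Tensorization to finite products\<close>

interpretation std_gaussian_1d: product_sigma_finite "\<lambda>_. std_gaussian_1d"
  by (intro product_sigma_finite.intro prob_space_imp_sigma_finite prob_space_std_gaussian_1d)

text \<open>Integrating out all coordinates but \<open>i\<close> leaves functions \<open>U\<close>
  and \<open>V\<close> of one variable; the induction hypothesis shows that they satisfy the
  one-dimensional assumption. The bound is required on extensional functions only, which are the
  points of the product space.\<close>

lemma PiM_std_gaussian_1d_property_tau:
  fixes u v :: "('i \<Rightarrow> real) \<Rightarrow> ennreal"
  assumes "finite I"
    and "u \<in> borel_measurable (PiM I (\<lambda>_. std_gaussian_1d))"
    and "v \<in> borel_measurable (PiM I (\<lambda>_. std_gaussian_1d))"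
    and "\<And>x y. x \<in> extensional I \<Longrightarrow> y \<in> extensional I \<Longrightarrow>
      u x * v y \<le> ennreal (exp ((\<Sum>i\<in>I. (x i - y i)\<^sup>2) / 4))"
  shows "(\<integral>\<^sup>+x. u x \<partial>PiM I (\<lambda>_. std_gaussian_1d)) * (\<integral>\<^sup>+x. v x \<partial>PiM I (\<lambda>_. std_gaussian_1d)) \<le> 1"
  using assms
proof (induction I arbitrary: u v rule: finite_induct)
  case empty
  then show ?case by (simp add: PiM_empty nn_integral_count_space_finite)
next
  case (insert i I)
  let ?P = "PiM I (\<lambda>_. std_gaussian_1d)"
  note [measurable] = insert.prems(1,2)
  interpret P: sigma_finite_measure ?P
    by (rule std_gaussian_1d.sigma_finite) fact
  define U where "U a = (\<integral>\<^sup>+x. u (x(i := a)) \<partial>?P)" for a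
  define V where "V a = (\<integral>\<^sup>+x. v (x(i := a)) \<partial>?P)" for a
  have [measurable]: "U \<in> borel_measurable borel" "V \<in> borel_measurable borel"
    unfolding U_def V_def by measurable
  have UV: "U a * V b \<le> ennreal (exp ((a - b)\<^sup>2 / 4))" for a b
  proof -
    define d where "d = (a - b)\<^sup>2 / 4"
    \<comment> \<open>The contribution \<open>exp d\<close> of coordinate \<open>i\<close> is
      constant here, so it is absorbed into \<open>v\<close> as \<open>exp (- d)\<close>; what
      remains is the bound over \<open>I\<close>.\<close>
    have "(\<integral>\<^sup>+x. u (x(i := a)) \<partial>?P) * (\<integral>\<^sup>+y. v (y(i := b)) * ennreal (exp (- d)) \<partial>?P) \<le> 1"
    proof (rule insert.IH)
      fix x y :: "'i \<Rightarrow> real"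
      assume xy: "x \<in> extensional I" "y \<in> extensional I"
      let ?s = "(\<Sum>j\<in>I. (x j - y j)\<^sup>2) / 4"
      have "u (x(i := a)) * v (y(i := b)) \<le>
          ennreal (exp ((\<Sum>j\<in>insert i I. ((x(i := a)) j - (y(i := b)) j)\<^sup>2) / 4))"
        using xy by (intro insert.prems) (auto simp: extensional_def)
      also have "(\<Sum>j\<in>insert i I. ((x(i := a)) j - (y(i := b)) j)\<^sup>2) / 4 = d + ?s"
      proof -
        have "(\<Sum>j\<in>I. ((x(i := a)) j - (y(i := b)) j)\<^sup>2) = (\<Sum>j\<in>I. (x j - y j)\<^sup>2)"
          using insert.hyps by (intro sum.cong) auto
        then show ?thesis
          using insert.hyps by (simp add: d_def add_divide_distrib)
      qed
      finally have "u (x(i := a)) * v (y(i := b)) * ennreal (exp (- d))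
          \<le> ennreal (exp (d + ?s)) * ennreal (exp (- d))"
        by (rule mult_right_mono) simp
      also have "\<dots> = ennreal (exp ?s)"
        by (simp flip: ennreal_mult exp_add)
      finally show "u (x(i := a)) * (v (y(i := b)) * ennreal (exp (- d))) \<le> ennreal (exp ?s)"
        by (simp add: mult_ac)
    qed measurable
    also have "(\<integral>\<^sup>+y. v (y(i := b)) * ennreal (exp (- d)) \<partial>?P) = V b * ennreal (exp (- d))"
      unfolding V_def by (rule nn_integral_multc) measurable
    finally have "U a * V b * ennreal (exp (- d)) \<le> 1"
      unfolding U_def by (simp only: mult_ac)
    then have "U a * V b * ennreal (exp (- d)) * ennreal (exp d) \<le> 1 * ennreal (exp d)"
      by (rule mult_right_mono) simp
    moreover have "ennreal (exp (- d)) * ennreal (exp d) = 1"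
      by (simp flip: ennreal_mult exp_add)
    ultimately show ?thesis by (simp add: mult.assoc d_def)
  qed
  show ?case
    \<comment> \<open>Fubini with coordinate \<open>i\<close> outermost turns the integrals of
      \<open>u\<close> and \<open>v\<close> into those of \<open>U\<close> and
      \<open>V\<close>.\<close>
    using std_gaussian_1d_property_tau[OF _ _ UV] insert
    by (simp add: std_gaussian_1d.product_nn_integral_insert_rev U_def V_def)
qed

section \<open>Transfer to vectors and the exponential moment\<close>

text \<open>Pulled back along \<open>vec_lambda\<close>, the squared Euclidean norm is the sum of
  squared coordinate differences, so this is the product case with index set
  \<open>UNIV\<close>.\<close>

lemma std_gaussian_property_tau:
  fixes u v :: "real ^ 'n \<Rightarrow> ennreal"
  assumes [measurable]: "u \<in> borel_measurable borel" "v \<in> borel_measurable borel"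
    and le: "\<And>x y. u x * v y \<le> ennreal (exp ((norm (x - y))\<^sup>2 / 4))"
  shows "(\<integral>\<^sup>+x. u x \<partial>std_gaussian) * (\<integral>\<^sup>+x. v x \<partial>std_gaussian) \<le> 1"
proof -
  have [measurable]:
    "(\<lambda>x. \<chi> i. x i) \<in> PiM (UNIV :: 'n set) (\<lambda>_. std_gaussian_1d) \<rightarrow>\<^sub>M (borel :: (real ^ 'n) measure)"
  proof (subst borel_measurable_euclidean_space, intro ballI)
    show "(\<lambda>x. (\<chi> i. x i) \<bullet> b) \<in> borel_measurable (PiM (UNIV :: 'n set) (\<lambda>_. std_gaussian_1d))" for b :: "real ^ 'n"
      unfolding inner_vec_def by simp
  qed
  have norm_sq: "(norm x)\<^sup>2 = (\<Sum>i\<in>UNIV. (x $ i)\<^sup>2)" for x :: "real ^ 'n"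
    by (simp add: norm_vec_def L2_set_def sum_nonneg)
  show ?thesis
    unfolding std_gaussian_def
    using PiM_std_gaussian_1d_property_tau[of "UNIV :: 'n set" "\<lambda>x. u (\<chi> i. x i)" "\<lambda>x. v (\<chi> i. x i)"]
      le[of "\<chi> i. _ i" "\<chi> i. _ i"]
    by (simp add: nn_integral_distr norm_sq)
qed

text \<open>Integrability is claimed as well because the Bochner integral of a non-integrable
  function is \<open>0\<close> by convention, which would make the inequality alone say nothing in
  that case.\<close>

theorem corollary2:
  fixes \<phi> :: "real ^ 'n \<Rightarrow> real"
    and M :: "'m measure"
    and X Y :: "'m \<Rightarrow> real ^ 'n"
    and l :: real
  assumes lipschitz: "1-lipschitz_on UNIV \<phi>"
    and prob: "prob_space M"
    and X_meas: "X \<in> borel_measurable M"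
    and Y_meas: "Y \<in> borel_measurable M"
    and X_distr: "distr M borel X = std_gaussian"
    and Y_distr: "distr M borel Y = std_gaussian"
    and indep: "prob_space.indep_var M borel X borel Y"
  shows "integrable M (\<lambda>\<omega>. exp (l / sqrt 2 * (\<phi> (X \<omega>) - \<phi> (Y \<omega>))))
    \<and> prob_space.expectation M (\<lambda>\<omega>. exp (l / sqrt 2 * (\<phi> (X \<omega>) - \<phi> (Y \<omega>)))) \<le> exp (l\<^sup>2 / 2)"
proof -
  interpret prob_space M by (rule prob)
  note [measurable] = X_meas Y_meas
  have [measurable]: "\<phi> \<in> borel_measurable borel"
    by (intro borel_measurable_continuous_onI lipschitz_on_continuous_on[OF lipschitz])
  define t where "t = l / sqrt 2"
  have t2: "t\<^sup>2 = l\<^sup>2 / 2" by (simp add: t_def power_divide)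
  define u where "u x = ennreal (exp (t * \<phi> x - t\<^sup>2))" for x
  define v where "v y = ennreal (exp (- t * \<phi> y))" for y
  have [measurable]: "u \<in> borel_measurable borel" "v \<in> borel_measurable borel"
    unfolding u_def v_def by measurable
  have "u x * v y \<le> ennreal (exp ((norm (x - y))\<^sup>2 / 4))" for x y
  proof -
    have "t * (\<phi> x - \<phi> y) \<le> \<bar>t\<bar> * \<bar>\<phi> x - \<phi> y\<bar>"
      by (metis abs_ge_self abs_mult)
    also have "\<dots> \<le> \<bar>t\<bar> * norm (x - y)"
      using lipschitz_onD[OF lipschitz, of x y]
      by (intro mult_left_mono) (auto simp: dist_norm)
    \<comment> \<open>The difference of the two sides is the square of
      \<open>\<bar>t\<bar> - norm (x - y) / 2\<close>.\<close>
    also have "\<dots> \<le> t\<^sup>2 + (norm (x - y))\<^sup>2 / 4"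
      using zero_le_power2[of "\<bar>t\<bar> - norm (x - y) / 2"] by (simp add: power2_diff power_divide)
    finally have "t * \<phi> x - t\<^sup>2 + (- t * \<phi> y) \<le> (norm (x - y))\<^sup>2 / 4"
      by (simp add: algebra_simps)
    then show ?thesis
      unfolding u_def v_def by (simp flip: ennreal_mult exp_add)
  qed
  then have "(\<integral>\<^sup>+x. u x \<partial>std_gaussian) * (\<integral>\<^sup>+y. v y \<partial>std_gaussian) \<le> 1"
    by (intro std_gaussian_property_tau) auto
  moreover have "(\<integral>\<^sup>+\<omega>. u (X \<omega>) * v (Y \<omega>) \<partial>M) = (\<integral>\<^sup>+x. u x \<partial>std_gaussian) * (\<integral>\<^sup>+y. v y \<partial>std_gaussian)"
  proof -
    \<comment> \<open>By independence the joint law is the product of the marginal laws, and Fubini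
      splits the integral.\<close>
    interpret Y: prob_space "distr M borel Y" by (rule prob_space_distr) simp
    have "(\<integral>\<^sup>+\<omega>. u (X \<omega>) * v (Y \<omega>) \<partial>M)
        = (\<integral>\<^sup>+z. u (fst z) * v (snd z) \<partial>distr M (borel \<Otimes>\<^sub>M borel) (\<lambda>\<omega>. (X \<omega>, Y \<omega>)))"
      by (simp add: nn_integral_distr)
    also have "\<dots> = (\<integral>\<^sup>+z. u (fst z) * v (snd z) \<partial>(distr M borel X \<Otimes>\<^sub>M distr M borel Y))"
      using indep by (simp add: indep_var_distribution_eq)
    also have "\<dots> = (\<integral>\<^sup>+x. (\<integral>\<^sup>+y. u x * v y \<partial>distr M borel Y) \<partial>distr M borel X)"
      by (subst Y.nn_integral_fst[symmetric]) auto
    also have "\<dots> = (\<integral>\<^sup>+x. u x \<partial>distr M borel X) * (\<integral>\<^sup>+y. v y \<partial>distr M borel Y)"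
      by (simp add: nn_integral_cmult nn_integral_multc)
    finally show ?thesis by (simp add: X_distr Y_distr)
  qed
  ultimately have le1: "(\<integral>\<^sup>+\<omega>. u (X \<omega>) * v (Y \<omega>) \<partial>M) \<le> 1" by simp
  \<comment> \<open>Restoring the factor \<open>exp (t\<^sup>2)\<close> that was divided out in
    \<open>u\<close> gives the stated constant, as \<open>t\<^sup>2 = l\<^sup>2 / 2\<close>.\<close>
  have "(\<integral>\<^sup>+\<omega>. ennreal (exp (t * (\<phi> (X \<omega>) - \<phi> (Y \<omega>)))) \<partial>M)
      = (\<integral>\<^sup>+\<omega>. ennreal (exp (t\<^sup>2)) * (u (X \<omega>) * v (Y \<omega>)) \<partial>M)"
    unfolding u_def v_def
    by (intro nn_integral_cong) (simp add: algebra_simps flip: ennreal_mult exp_add)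
  also have "\<dots> = ennreal (exp (t\<^sup>2)) * (\<integral>\<^sup>+\<omega>. u (X \<omega>) * v (Y \<omega>) \<partial>M)"
    by (rule nn_integral_cmult) measurable
  also have "\<dots> \<le> ennreal (exp (t\<^sup>2))"
    using mult_left_mono[OF le1] by fastforce
  finally have bound: "(\<integral>\<^sup>+\<omega>. ennreal (exp (t * (\<phi> (X \<omega>) - \<phi> (Y \<omega>)))) \<partial>M) \<le> ennreal (exp (t\<^sup>2))" .
  have int: "integrable M (\<lambda>\<omega>. exp (t * (\<phi> (X \<omega>) - \<phi> (Y \<omega>))))"
    by (rule integrableI_nonneg) (use bound in \<open>auto intro: le_less_trans\<close>)
  moreover have "expectation (\<lambda>\<omega>. exp (t * (\<phi> (X \<omega>) - \<phi> (Y \<omega>)))) \<le> exp (t\<^sup>2)"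
    using bound by (subst (asm) nn_integral_eq_integral[OF int]) auto
  ultimately show ?thesis by (simp add: t_def t2[unfolded t_def])
qed

end
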